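(* Let $N\ge 1$, let $\mathbf{A}_0\in\mathbb{R}^{N\times N}$ be symmetric, let $\mathbf{A}_1\in\mathbb{R}^{N\times N}$ be symmetric positive definite, let $\mathbf{b}_0,\mathbf{b}_1\in\mathbb{R}^N$ and $c_0,c_1\in\mathbb{R}$, and assume $-\mathbf{b}_1^T\mathbf{A}_1^{-1}\mathbf{b}_1+c_1\le 0$. Let $\mathbf{T}\in\mathbb{R}^{N\times N}$ be an invertible matrix and $\boldsymbol{\Lambda}_0\in\mathbb{R}^{N\times N}$ a diagonal matrix such that $\mathbf{A}_0=\mathbf{T}\boldsymbol{\Lambda}_0\mathbf{T}^T$ and $\mathbf{A}_1=\mathbf{T}\mathbf{T}^T$. Set $$c=\left(\mathbf{T}^{-1}\mathbf{b}_1\right)^T\left(\mathbf{T}^{-1}\mathbf{b}_1\right)-c_1,\qquad \mathbf{b}=\boldsymbol{\Lambda}_0\mathbf{T}^{-1}\mathbf{b}_1-\mathbf{T}^{-1}\mathbf{b}_0 .$$ Then $c\ge 0$, and there is a constant $\mathrm{const}\in\mathbb{R}$, not depending on $\mathbf{x}$, such that for every $\mathbf{x}\in\mathbb{R}^N$, with $\mathbf{y}=\mathbf{T}^T\mathbf{x}+\mathbf{T}^{-1}\mathbf{b}_1$, $$\mathbf{x}^T\mathbf{A}_1\mathbf{x}+2\mathbf{b}_1^T\mathbf{x}+c_1=\mathbf{y}^T\mathbf{y}-c$$ and $$\mathbf{x}^T\mathbf{A}_0\mathbf{x}+2\mathbf{b}_0^T\mathbf{x}+c_0=\mathbf{y}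^T\boldsymbol{\Lambda}_0\mathbf{y}-2\mathbf{b}^T\mathbf{y}+\mathrm{const}.$$
   Context: The setting is the single-equality-constraint quadratically constrained quadratic program (QCQP): minimize $\mathbf{x}^T\mathbf{A}_0\mathbf{x}+2\mathbf{b}_0^T\mathbf{x}+c_0$ over $\mathbf{x}\in\mathbb{R}^N$ subject to $\mathbf{x}^T\mathbf{A}_1\mathbf{x}+2\mathbf{b}_1^T\mathbf{x}+c_1=0$, where $\mathbf{A}_0$ is symmetric and $\mathbf{A}_1$ is positive definite. The condition $-\mathbf{b}_1^T\mathbf{A}_1^{-1}\mathbf{b}_1+c_1\le 0$ is the standing assumption ensuring that the constraint set is nonempty. A pair $(\mathbf{T},\boldsymbol{\Lambda}_0)$ with the stated properties always exists, by the standard simultaneous diagonalization of a symmetric matrix and a positive definite matrix. *)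

theory Defs
  imports "HOL-Analysis.Analysis"
begin

definition symmetric_matrix :: "real ^ 'n ^ 'n \<Rightarrow> bool"
  where "symmetric_matrix A \<longleftrightarrow> transpose A = A"

definition positive_definite_matrix :: "real ^ 'n ^ 'n \<Rightarrow> bool"
  where "positive_definite_matrix A \<longleftrightarrow>
    symmetric_matrix A \<and> (\<forall>x. x \<noteq> 0 \<longrightarrow> x \<bullet> (A *v x) > 0)"

definition diagonal_matrix :: "real ^ 'n ^ 'n \<Rightarrow> bool"
  where "diagonal_matrix D \<longleftrightarrow> (\<forall>i j. i \<noteq> j \<longrightarrow> D $ i $ j = 0)"

end

theory Submission
  imports Defs
begin

text \<open>
  In the coordinates \<open>u = T\<^sup>T x\<close>, \<open>d = T\<^sup>-\<^sup>1 b1\<close>, \<open>e = T\<^sup>-\<^sup>1 b0\<close>, the constraint becomes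
  \<open>u \<bullet> u + 2 d \<bullet> u + c1\<close> and the objective \<open>u \<bullet> \<Lambda>0 u + 2 e \<bullet> u + c0\<close>; the substitution \<open>y = u + d\<close>
  completes the square in the former. Since \<open>A1\<^sup>-\<^sup>1 b1 = T\<^sup>-\<^sup>T d\<close>, the feasibility condition is \<open>c1 \<le> d \<bullet> d\<close>.
\<close>

lemma inner_matrix_vector_transpose:
  fixes A :: "real ^ 'n ^ 'm"
  shows "(A *v x) \<bullet> y = x \<bullet> (transpose A *v y)"
  by (metis dot_lmul_matrix inner_commute transpose_matrix_vector)

lemma diagonal_matrix_transpose:
  assumes "diagonal_matrix D"
  shows "transpose D = D"
  using assms by (auto simp: diagonal_matrix_def transpose_def vec_eq_iff) metis

lemma matrix_vector_matrix_inv_cancel: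
  fixes A :: "real ^ 'n ^ 'n"
  assumes "invertible A"
  shows "A *v (matrix_inv A *v x) = x"
  \<comment> \<open>\<open>matrix_inv\<close> is a Hilbert choice, so invertibility supplies its
    defining equations.\<close>
  using someI_ex[OF assms[unfolded invertible_def], folded matrix_inv_def]
  by (simp add: matrix_vector_mul_assoc)

text \<open>Cancelling the injective \<open>T\<close> in
  \<open>T *v (transpose T *v w) = v = T *v d\<close> gives \<open>transpose T *v w = d\<close>, and
  moving \<open>T\<close> across the inner product turns \<open>v \<bullet> w\<close> into
  \<open>d \<bullet> d\<close>. At \<open>v = b1\<close> this makes the feasibility condition say
  \<open>c \<ge> 0\<close>.\<close>

lemma inner_matrix_inv_mult_transpose:
  fixes T :: "real ^ 'n ^ 'n"
  assumes "invertible T"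
  shows "v \<bullet> (matrix_inv (T ** transpose T) *v v) = (matrix_inv T *v v) \<bullet> (matrix_inv T *v v)"
proof -
  define d w where "d = matrix_inv T *v v" and "w = matrix_inv (T ** transpose T) *v v"
  have v: "T *v d = v"
    unfolding d_def using assms by (rule matrix_vector_matrix_inv_cancel)
  have "invertible (T ** transpose T)"
    using assms by (simp add: invertible_mult transpose_invertible)
  then have "T *v (transpose T *v w) = v"
    unfolding w_def by (metis matrix_vector_mul_assoc matrix_vector_matrix_inv_cancel)
  then have "transpose T *v w = d"
    using v assms by (metis inj_matrix_vector_mult injD)
  then have "v \<bullet> w = d \<bullet> d"
    using inner_matrix_vector_transpose[of T d w] v by simp
  then show ?thesis by (simp add: d_def w_def)
qed

theorem theorem2:
  fixes A0 A1 T \<Lambda>0 :: "real ^ 'n ^ 'n"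
    and b0 b1 b :: "real ^ 'n"
    and c0 c1 c :: real
  assumes "symmetric_matrix A0"
    and "positive_definite_matrix A1"
    and "- (b1 \<bullet> (matrix_inv A1 *v b1)) + c1 \<le> 0"
    and "invertible T"
    and "diagonal_matrix \<Lambda>0"
    and "A0 = T ** \<Lambda>0 ** transpose T"
    and "A1 = T ** transpose T"
    and c_def: "c = (matrix_inv T *v b1) \<bullet> (matrix_inv T *v b1) - c1"
    and b_def: "b = \<Lambda>0 *v (matrix_inv T *v b1) - matrix_inv T *v b0"
  shows "c \<ge> 0 \<and>
    (\<exists>const. \<forall>x y. y = transpose T *v x + matrix_inv T *v b1 \<longrightarrow>
      x \<bullet> (A1 *v x) + 2 * (b1 \<bullet> x) + c1 = y \<bullet> y - c \<and>
      x \<bullet> (A0 *v x) + 2 * (b0 \<bullet> x) + c0 = y \<bullet> (\<Lambda>0 *v y) - 2 * (b \<bullet> y) + const)"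
proof -
  define d e where "d = matrix_inv T *v b1" and "e = matrix_inv T *v b0"
  have b1: "b1 = T *v d" and b0: "b0 = T *v e"
    using \<open>invertible T\<close> by (simp_all add: d_def e_def matrix_vector_matrix_inv_cancel)
  have c: "c = d \<bullet> d - c1" and b: "b = \<Lambda>0 *v d - e"
    by (simp_all add: c_def b_def d_def e_def)
  have sym: "(\<Lambda>0 *v p) \<bullet> q = p \<bullet> (\<Lambda>0 *v q)" for p q
    using diagonal_matrix_transpose[OF \<open>diagonal_matrix \<Lambda>0\<close>]
    by (simp add: inner_matrix_vector_transpose)
  have "c \<ge> 0"
    using assms(3) inner_matrix_inv_mult_transpose[OF \<open>invertible T\<close>, of b1]
    by (simp add: c_def \<open>A1 = T ** transpose T\<close>)
  \<comment> \<open>The constant is what remains free of \<open>y\<close> when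
    \<open>u = y - d\<close> is substituted into
    \<open>u \<bullet> (\<Lambda>0 *v u) + 2 * (e \<bullet> u) + c0\<close>.\<close>
  moreover have "x \<bullet> (A1 *v x) + 2 * (b1 \<bullet> x) + c1 = y \<bullet> y - c \<and>
      x \<bullet> (A0 *v x) + 2 * (b0 \<bullet> x) + c0
        = y \<bullet> (\<Lambda>0 *v y) - 2 * (b \<bullet> y) + (c0 + d \<bullet> (\<Lambda>0 *v d) - 2 * (e \<bullet> d))"
    if y: "y = transpose T *v x + d" for x y
  proof -
    define u where "u = transpose T *v x"
    have lin: "b1 \<bullet> x = d \<bullet> u" "b0 \<bullet> x = e \<bullet> u"
      by (simp_all add: b1 b0 u_def inner_matrix_vector_transpose)
    have push: "x \<bullet> (T *v z) = u \<bullet> z" for z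
      by (metis inner_commute inner_matrix_vector_transpose u_def)
    \<comment> \<open>The deleted simp rule would turn \<open>transpose T *v x\<close> into
      \<open>x v* T\<close> and block reassociation.\<close>
    have "A1 *v x = T *v u" "A0 *v x = T *v (\<Lambda>0 *v u)"
      by (simp_all add: \<open>A1 = T ** transpose T\<close> \<open>A0 = T ** \<Lambda>0 ** transpose T\<close> u_def
          matrix_vector_mul_assoc matrix_mul_assoc del: transpose_matrix_vector)
    then have quad: "x \<bullet> (A1 *v x) = u \<bullet> u" "x \<bullet> (A0 *v x) = u \<bullet> (\<Lambda>0 *v u)"
      by (simp_all add: push)
    have yu: "y = u + d" by (simp add: y u_def)
    \<comment> \<open>The two mixed terms of \<open>y \<bullet> (\<Lambda>0 *v y)\<close> agree, so
      the \<open>\<Lambda>0 *v d\<close> part of \<open>b\<close> cancels both.\<close>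
    have "d \<bullet> (\<Lambda>0 *v u) = u \<bullet> (\<Lambda>0 *v d)"
      by (metis inner_commute sym)
    then show ?thesis
      unfolding lin quad yu c b
      by (simp add: matrix_vector_right_distrib inner_add_left inner_add_right inner_diff_left
          sym inner_commute[of u d] algebra_simps)
  qed
  ultimately show ?thesis unfolding d_def by blast
qed

end
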